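(* Equip $\mathbb{R}^3$ with the norm $\|(x,y,z)\|:=\sqrt{|z^2-(x^2+y^2)|+3z^2+x^2+y^2}$. Let $\eta:(0,2]\to(0,1]$ be a modulus of uniform convexity for $\mathbb{R}^3$ with the Euclidean norm $\|\cdot\|_2$ (e.g. $\eta(\varepsilon)=\varepsilon^2/8$). Then $$\delta(\varepsilon):=\min\left\{\frac{\eta\!\left(\frac{\sqrt2\,\varepsilon}{256}\right)}{\sqrt2},\ \frac{\varepsilon}{128}\right\}$$ is, for $0<\varepsilon\le1$, a modulus for the following property of $(\mathbb{R}^3,\|\cdot\|)$: for all $0<\varepsilon\le 1$ and all $u,v,w\in\mathbb{R}^3$ with $\|u\|=\|v\|=\|w\|=1$, $$\min\left\{\left\|\frac{u+v}{2}\right\|,\left\|\frac{v+w}{2}\right\|\right\}\ge1-\delta(\varepsilon)\ \Longrightarrow\ \|u+v+w\|\ge3-\varepsilon .$$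
   Context: A function $\eta:(0,2]\to(0,1]$ is a modulus of uniform convexity for $(\mathbb{R}^3,\|\cdot\|_2)$ if for all $\varepsilon\in(0,2]$, $r>0$ and $p,x,y\in\mathbb{R}^3$: $\|p-x\|_2\le r$, $\|p-y\|_2\le r$ and $\|x-y\|_2\ge\varepsilon r$ imply $\|p-\frac{x+y}{2}\|_2\le(1-\eta(\varepsilon))r$. *)

theory Defs
  imports "HOL-Analysis.Analysis"
begin

text \<open>
  On \<^typ>\<open>real^3\<close> the library norm \<^term>\<open>norm\<close> is the Euclidean norm. The second norm
  on the same space is a separate function; that it is a norm is shown below.
\<close>

definition nrm :: "real^3 \<Rightarrow> real" where
  "nrm p = sqrt (\<bar>(p$3)\<^sup>2 - ((p$1)\<^sup>2 + (p$2)\<^sup>2)\<bar> + 3 * (p$3)\<^sup>2 + (p$1)\<^sup>2 + (p$2)\<^sup>2)"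

text \<open>
  A function from \<open>(0,2]\<close> to \<open>(0,1]\<close> is a total function on the reals, constrained only
  on \<open>{0<..2}\<close>.
\<close>

definition uniform_convexity_modulus :: "(real \<Rightarrow> real) \<Rightarrow> bool" where
  "uniform_convexity_modulus \<eta> \<longleftrightarrow>
     (\<forall>\<epsilon>\<in>{0<..2}. \<eta> \<epsilon> \<in> {0<..1}) \<and>
     (\<forall>\<epsilon>\<in>{0<..2}. \<forall>r>0. \<forall>p x y :: real^3.
        norm (p - x) \<le> r \<longrightarrow> norm (p - y) \<le> r \<longrightarrow> norm (x - y) \<ge> \<epsilon> * r \<longrightarrow>
        norm (p - (1/2) *\<^sub>R (x + y)) \<le> (1 - \<eta> \<epsilon>) * r)"

definition delta :: "(real \<Rightarrow> real) \<Rightarrow> real \<Rightarrow> real" where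
  "delta \<eta> \<epsilon> = min (\<eta> (sqrt 2 * \<epsilon> / 256) / sqrt 2) (\<epsilon> / 128)"

lemma nrm_eq_max: "nrm p = max (2 * \<bar>p$3\<bar>) (sqrt 2 * norm p)"
proof -
  have n: "(norm p)\<^sup>2 = (p$1)\<^sup>2 + (p$2)\<^sup>2 + (p$3)\<^sup>2"
    by (simp add: norm_vec_def L2_set_def sum_3)
  have m: "sqrt (max a b) = max (sqrt a) (sqrt b)" for a b
    by (simp add: max_def)
  have "\<bar>(p$3)\<^sup>2 - ((p$1)\<^sup>2 + (p$2)\<^sup>2)\<bar> + 3 * (p$3)\<^sup>2 + (p$1)\<^sup>2 + (p$2)\<^sup>2
        = max (4 * (p$3)\<^sup>2) (2 * (norm p)\<^sup>2)"
    unfolding n by (simp add: max_def abs_if)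
  then show ?thesis
    by (simp add: nrm_def m real_sqrt_mult)
qed

lemma nrm_eq_0_iff: "nrm p = 0 \<longleftrightarrow> p = 0"
proof
  assume "nrm p = 0"
  then have "sqrt 2 * norm p \<le> 0" unfolding nrm_eq_max by linarith
  then show "p = 0" by (simp add: mult_le_0_iff)
qed (simp add: nrm_eq_max)

lemma nrm_scaleR: "nrm (c *\<^sub>R p) = \<bar>c\<bar> * nrm p"
  unfolding nrm_eq_max by (simp add: max_mult_distrib_left abs_mult mult_ac)

lemma nrm_triangle: "nrm (p + q) \<le> nrm p + nrm q"
proof -
  have "sqrt 2 * norm (p + q) \<le> sqrt 2 * norm p + sqrt 2 * norm q"
    using norm_triangle_ineq[of p q] by (simp flip: distrib_left)
  moreover have "\<bar>p$3 + q$3\<bar> \<le> \<bar>p$3\<bar> + \<bar>q$3\<bar>" by (rule abs_triangle_ineq)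
  ultimately show ?thesis
    unfolding nrm_eq_max vector_add_component max_def by (smt (verit))
qed

lemma uniform_convexity_modulus_square: "uniform_convexity_modulus (\<lambda>\<epsilon>. \<epsilon>\<^sup>2 / 8)"
  unfolding uniform_convexity_modulus_def
proof (intro conjI ballI allI impI)
  fix e :: real assume "e \<in> {0<..2}"
  then have "0 < e" "e \<le> 2" by auto
  then have "e\<^sup>2 \<le> 2\<^sup>2" by (intro power_mono) auto
  with \<open>0 < e\<close> show "e\<^sup>2 / 8 \<in> {0<..1}" by auto
next
  fix e r :: real and p x y :: "real^3"
  assume e: "e \<in> {0<..2}" and r: "0 < r" and
    px: "norm (p - x) \<le> r" and py: "norm (p - y) \<le> r" and xy: "e * r \<le> norm (x - y)"
  let ?m = "norm (p - (1/2) *\<^sub>R (x + y))"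
  have "(norm (p - x))\<^sup>2 \<le> r\<^sup>2" "(norm (p - y))\<^sup>2 \<le> r\<^sup>2"
    using px py by (auto intro!: power_mono)
  moreover have "(e * r)\<^sup>2 \<le> (norm (x - y))\<^sup>2"
    using xy e r by (intro power_mono) auto
  moreover have "4 * ?m\<^sup>2 = 2 * (norm (p - x))\<^sup>2 + 2 * (norm (p - y))\<^sup>2 - (norm (x - y))\<^sup>2"
    by (simp add: power2_norm_eq_inner inner_simps inner_commute algebra_simps)
  ultimately have "?m\<^sup>2 \<le> r\<^sup>2 - (e * r)\<^sup>2 / 4" by linarith
  also have "\<dots> \<le> ((1 - e\<^sup>2 / 8) * r)\<^sup>2"
  proof -
    have "((1 - e\<^sup>2 / 8) * r)\<^sup>2 = r\<^sup>2 - (e * r)\<^sup>2 / 4 + (e\<^sup>2 * r / 8)\<^sup>2"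
      by (simp add: power2_eq_square algebra_simps)
    then show ?thesis by simp
  qed
  finally have *: "?m\<^sup>2 \<le> ((1 - e\<^sup>2 / 8) * r)\<^sup>2" .
  have "e\<^sup>2 \<le> 2\<^sup>2" using e by (intro power_mono) auto
  then have "0 \<le> (1 - e\<^sup>2 / 8) * r" using r by simp
  with * show "?m \<le> (1 - e\<^sup>2 / 8) * r" by (rule power2_le_imp_le)
qed

lemma delta_pos:
  assumes "uniform_convexity_modulus \<eta>" "0 < \<epsilon>" "\<epsilon> \<le> 1"
  shows "0 < delta \<eta> \<epsilon>"
proof -
  have "sqrt 2 * \<epsilon> \<le> 2 * 1"
    using assms(2,3) sqrt2_less_2 by (intro mult_mono) auto
  then have "sqrt 2 * \<epsilon> / 256 \<in> {0<..2}" using assms(2) by simp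
  then have "0 < \<eta> (sqrt 2 * \<epsilon> / 256)"
    using assms(1) unfolding uniform_convexity_modulus_def by auto
  then show ?thesis using assms(2) by (simp add: delta_def)
qed

end

theory Submission
  imports Defs
begin

text \<open>
  The norm is the maximum of twice the height and \<open>\<surd>2\<close> times the Euclidean norm. If the
  Euclidean part witnesses that the midpoint of \<open>u\<close> and \<open>v\<close> has norm almost one, uniform
  convexity makes \<open>u\<close> and \<open>v\<close> close, so \<open>u + v + w\<close> is close to \<open>2v + w = 2(v + w) - w\<close>.
  If for both midpoints the height witnesses it, the heights of \<open>u\<close>, \<open>v\<close>, \<open>w\<close> have the same
  sign and absolute value almost \<open>1/2\<close>, so they add up.
\<close>

lemma nrm_minus_commute: "nrm (p - q) = nrm (q - p)"
  using nrm_scaleR[of "-1" "p - q"] by simp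

lemma nrm_diff_ge: "nrm p - nrm q \<le> nrm (p - q)"
  using nrm_triangle[of "p - q" q] by simp

lemma nrm_le_2_norm: "nrm p \<le> 2 * norm p"
proof -
  have "sqrt 2 * norm p \<le> 2 * norm p"
    using sqrt2_less_2 by (intro mult_right_mono) auto
  then show ?thesis
    using component_le_norm_cart[of p 3] by (simp add: nrm_eq_max)
qed

text \<open>Contrapositive of uniform convexity with centre 0 and radius \<open>1 / sqrt 2\<close>:
  the unit ball of \<open>nrm\<close> lies in that Euclidean ball.\<close>

lemma norm_diff_less_if_midpoint_large:
  fixes u v :: "real^3"
  assumes "uniform_convexity_modulus \<eta>" and "0 < e" "e \<le> 2"
    and "nrm u \<le> 1" "nrm v \<le> 1"
    and mid: "1 - \<eta> e < sqrt 2 * norm ((1/2) *\<^sub>R (u + v))"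
  shows "norm (u - v) < e / sqrt 2"
proof (rule ccontr)
  assume "\<not> ?thesis"
  then have "e * (1 / sqrt 2) \<le> norm (u - v)" by simp
  moreover have "norm (0 - u) \<le> 1 / sqrt 2" "norm (0 - v) \<le> 1 / sqrt 2"
    using assms(4,5) by (simp_all add: nrm_eq_max field_simps)
  moreover have "e \<in> {0<..2}" "0 < 1 / sqrt 2" using assms(2,3) by auto
  ultimately have "norm (0 - (1/2) *\<^sub>R (u + v)) \<le> (1 - \<eta> e) * (1 / sqrt 2)"
    using assms(1) unfolding uniform_convexity_modulus_def by blast
  then have "norm ((1/2) *\<^sub>R (u + v)) \<le> (1 - \<eta> e) * (1 / sqrt 2)"
    by (metis diff_0 norm_minus_cancel)
  then have "sqrt 2 * norm ((1/2) *\<^sub>R (u + v)) \<le> 1 - \<eta> e"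
    by (simp add: field_simps)
  with mid show False by linarith
qed

lemma nrm_sum3_ge_if_near:
  assumes "nrm w \<le> 1" and near: "nrm (u - v) \<le> t"
    and mid: "1 - d \<le> nrm ((1/2) *\<^sub>R (v + w))"
  shows "3 - 4 * d - t \<le> nrm (u + v + w)"
proof -
  let ?m = "(1/2) *\<^sub>R (v + w)"
  \<comment> \<open>The first term has norm at least \<open>4 - 4 * d\<close>; subtracting
    \<open>w\<close> and \<open>v - u\<close> costs at most 1 and \<open>t\<close>.\<close>
  have sum: "u + v + w = (4 *\<^sub>R ?m - w) - (v - u)"
    by (simp add: vec_eq_iff)
  have "nrm (4 *\<^sub>R ?m) - nrm w - nrm (v - u) \<le> nrm (u + v + w)"
    unfolding sum
    using nrm_diff_ge[of "4 *\<^sub>R ?m - w" "v - u"] nrm_diff_ge[of "4 *\<^sub>R ?m" w] by linarith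
  moreover have "nrm (4 *\<^sub>R ?m) = 4 * nrm ?m"
    by (subst nrm_scaleR) simp
  ultimately show ?thesis
    using assms nrm_minus_commute[of u v] by linarith
qed

text \<open>Heights are at most 1/2 in absolute value, so a sum of two of absolute value at least
  \<open>1 - d\<close> forces each to be at least \<open>1/2 - d > 0\<close> in absolute value, with
  equal signs. The shared \<open>v\<close> passes its sign to all three.\<close>

lemma nrm_sum3_ge_if_heights:
  fixes u v w :: "real^3"
  assumes "nrm u \<le> 1" "nrm v \<le> 1" "nrm w \<le> 1" and "d < 1/2"
    and "1 - d \<le> 2 * \<bar>((1/2) *\<^sub>R (u + v))$3\<bar>" "1 - d \<le> 2 * \<bar>((1/2) *\<^sub>R (v + w))$3\<bar>"
  shows "3 - 6 * d \<le> nrm (u + v + w)"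
proof -
  have "3 - 6 * d \<le> 2 * \<bar>u$3 + v$3 + w$3\<bar>"
    using assms by (simp add: nrm_eq_max) argo
  then show ?thesis by (simp add: nrm_eq_max)
qed

theorem proposition4p9:
  fixes \<eta> :: "real \<Rightarrow> real"
  assumes "uniform_convexity_modulus \<eta>"
  shows "\<forall>\<epsilon>::real. 0 < \<epsilon> \<and> \<epsilon> \<le> 1 \<longrightarrow>
    (\<forall>u v w :: real^3. nrm u = 1 \<and> nrm v = 1 \<and> nrm w = 1 \<longrightarrow>
      min (nrm ((1/2) *\<^sub>R (u + v))) (nrm ((1/2) *\<^sub>R (v + w))) \<ge> 1 - delta \<eta> \<epsilon> \<longrightarrow>
      nrm (u + v + w) \<ge> 3 - \<epsilon>)"
proof (intro allI impI, elim conjE)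
  fix \<epsilon> :: real and u v w :: "real^3"
  assume \<epsilon>: "0 < \<epsilon>" "\<epsilon> \<le> 1" and unit: "nrm u = 1" "nrm v = 1" "nrm w = 1"
    and "min (nrm ((1/2) *\<^sub>R (u + v))) (nrm ((1/2) *\<^sub>R (v + w))) \<ge> 1 - delta \<eta> \<epsilon>"
  then have uv: "1 - delta \<eta> \<epsilon> \<le> nrm ((1/2) *\<^sub>R (u + v))"
    and vw: "1 - delta \<eta> \<epsilon> \<le> nrm ((1/2) *\<^sub>R (v + w))" by auto
  define e where "e = sqrt 2 * \<epsilon> / 256"
  have "sqrt 2 * \<epsilon> \<le> 2 * 1"
    using \<epsilon> sqrt2_less_2 by (intro mult_mono) auto
  then have e: "0 < e" "e \<le> 2" using \<epsilon> by (auto simp: e_def)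
  then have "0 < \<eta> e" using assms unfolding uniform_convexity_modulus_def by auto
  \<comment> \<open>The factor \<open>1 / sqrt 2\<close> in \<open>delta\<close> supplies the strict
    inequality that the contrapositive asks for.\<close>
  then have "\<eta> e / sqrt 2 < \<eta> e" by (simp add: divide_less_eq)
  then have \<delta>: "delta \<eta> \<epsilon> < \<eta> e" "delta \<eta> \<epsilon> \<le> \<epsilon> / 128"
    unfolding delta_def e_def by linarith+
  have near: "nrm (x - y) \<le> \<epsilon> / 128"
    if "nrm x = 1" "nrm y = 1" "1 - delta \<eta> \<epsilon> \<le> sqrt 2 * norm ((1/2) *\<^sub>R (x + y))" for x y
  proof -
    have "norm (x - y) < e / sqrt 2"
      using that \<delta> by (intro norm_diff_less_if_midpoint_large[OF assms e]) auto
    \<comment> \<open>The \<open>sqrt 2\<close> in \<open>e\<close> cancels the one from the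
      radius.\<close>
    then have "norm (x - y) < \<epsilon> / 256" by (simp add: e_def)
    with nrm_le_2_norm[of "x - y"] show ?thesis by linarith
  qed
  \<comment> \<open>Writing \<open>w + v\<close> makes the second case the first with
    \<open>u\<close> and \<open>w\<close> exchanged. The total loss is at most
    \<open>5 * \<epsilon> / 128\<close> in these two cases and \<open>6 * \<epsilon> / 128\<close>
    in the third.\<close>
  consider "1 - delta \<eta> \<epsilon> \<le> sqrt 2 * norm ((1/2) *\<^sub>R (u + v))"
    | "1 - delta \<eta> \<epsilon> \<le> sqrt 2 * norm ((1/2) *\<^sub>R (w + v))"
    | "1 - delta \<eta> \<epsilon> \<le> 2 * \<bar>((1/2) *\<^sub>R (u + v))$3\<bar>" "1 - delta \<eta> \<epsilon> \<le> 2 * \<bar>((1/2) *\<^sub>R (v + w))$3\<bar>"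
    using uv vw unfolding nrm_eq_max add.commute[of w v] le_max_iff_disj by blast
  then show "nrm (u + v + w) \<ge> 3 - \<epsilon>"
  proof cases
    case 1
    then show ?thesis
      using nrm_sum3_ge_if_near[OF _ near[of u v] vw] unit \<delta> \<epsilon> by simp
  next
    case 2
    have "1 - delta \<eta> \<epsilon> \<le> nrm ((1/2) *\<^sub>R (v + u))" using uv by (simp add: add.commute)
    then have "3 - 4 * delta \<eta> \<epsilon> - \<epsilon> / 128 \<le> nrm (w + v + u)"
      using nrm_sum3_ge_if_near[OF _ near[of w v]] 2 unit by simp
    also have "w + v + u = u + v + w" by (simp add: ac_simps)
    finally show ?thesis using \<delta> \<epsilon> by simp
  next
    case 3
    then have "3 - 6 * delta \<eta> \<epsilon> \<le> nrm (u + v + w)"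
      using unit \<delta> \<epsilon> by (intro nrm_sum3_ge_if_heights) auto
    then show ?thesis using \<delta> \<epsilon> by simp
  qed
qed

end
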